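(* Let $I\subseteq[0,\infty)$ be a closed interval of positive length and let $H_1,H_2\in(0,1)$ with $H_1\neq H_2$. If $\{X_1(t),t\ge0\}$ and $\{X_2(t),t\ge0\}$ are fractional Brownian motions (with continuous sample paths) with parameters $H_1$ and $H_2$, respectively, then $X_1$ and $X_2$ are singular on $I$, i.e. $X_1\,\bot\,X_2$.
   Context: A fractional Brownian motion with parameter $H\in(0,1)$ is a zero-mean Gaussian process $\{X(t),t\geq 0\}$ with covariance function $\mathsf{Cov}(X(t_1),X(t_2))=\frac12\left(t_1^{2H}+t_2^{2H}-|t_1-t_2|^{2H}\right)$, $t_1,t_2\ge0$. $C(I)$ denotes the set of continuous real functions on the closed interval $I\subseteq[0,\infty)$ with the local uniform topology and Borel $\sigma$-algebra $\mathcal{B}(C(I))$. If $\{X_1(t),t\in I\}$ and $\{X_2(t),t\in I\}$ have sample paths in $C(I)$ a.s., they are called singular on $I$ ($X_1\,\bot\,X_2$) if their distributions $\mathsf{P}_{X_1},\mathsf{P}_{X_2}$ on $(C(I),\mathcal{B}(C(I)))$ are singular, i.e. there is $A\in\mathcal{B}(C(I))$ with $\mathsf{P}_{X_1}(A)=1$ and $\mathsf{P}_{X_2}(A)=0$. *)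

theory Defs
  imports "HOL-Probability.Probability"
begin

section \<open>Fractional Brownian motion\<close>

text \<open>Gaussian laws may be degenerate, as required e.g. for the value at time 0.\<close>

definition gaussian_rv :: "'a measure \<Rightarrow> ('a \<Rightarrow> real) \<Rightarrow> bool" where
  "gaussian_rv M Y \<longleftrightarrow> Y \<in> borel_measurable M \<and>
     (\<exists>\<mu> \<sigma>. (\<sigma> > 0 \<and> distributed M lborel Y (normal_density \<mu> \<sigma>)) \<or>
             (\<sigma> = 0 \<and> (AE \<omega> in M. Y \<omega> = \<mu>)))"

text \<open>The finite-dimensional laws are multivariate normal: every finite linear combination
  of the coordinates is a (possibly degenerate) Gaussian random variable.\<close>

definition gaussian_process :: "'a measure \<Rightarrow> real set \<Rightarrow> (real \<Rightarrow> 'a \<Rightarrow> real) \<Rightarrow> bool" where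
  "gaussian_process M T X \<longleftrightarrow> prob_space M \<and>
     (\<forall>S c. finite S \<and> S \<subseteq> T \<longrightarrow> gaussian_rv M (\<lambda>\<omega>. \<Sum>t\<in>S. c t * X t \<omega>))"

definition cov :: "'a measure \<Rightarrow> ('a \<Rightarrow> real) \<Rightarrow> ('a \<Rightarrow> real) \<Rightarrow> real" where
  "cov M Y Z = (\<integral>\<omega>. (Y \<omega> - (\<integral>\<omega>'. Y \<omega>' \<partial>M)) * (Z \<omega> - (\<integral>\<omega>'. Z \<omega>' \<partial>M)) \<partial>M)"

definition fractional_brownian_motion ::
  "'a measure \<Rightarrow> real \<Rightarrow> (real \<Rightarrow> 'a \<Rightarrow> real) \<Rightarrow> bool" where
  "fractional_brownian_motion M H X \<longleftrightarrow>
     0 < H \<and> H < 1 \<and> gaussian_process M {0..} X \<and>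
     (\<forall>t\<ge>0. (\<integral>\<omega>. X t \<omega> \<partial>M) = 0) \<and>
     (\<forall>t1\<ge>0. \<forall>t2\<ge>0. cov M (X t1) (X t2) =
        (t1 powr (2 * H) + t2 powr (2 * H) - \<bar>t1 - t2\<bar> powr (2 * H)) / 2)"

text \<open>Almost surely continuous sample paths. The exceptional set need not be measurable.\<close>

definition continuous_paths_on ::
  "'a measure \<Rightarrow> real set \<Rightarrow> (real \<Rightarrow> 'a \<Rightarrow> real) \<Rightarrow> bool" where
  "continuous_paths_on M T X \<longleftrightarrow> (AE \<omega> in M. continuous_on T (\<lambda>t. X t \<omega>))"

section \<open>The path space of continuous functions on an interval\<close>

text \<open>A continuous function on \<open>I\<close> is represented by a function that is \<open>undefined\<close> outside \<open>I\<close>.\<close>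

definition C_carrier :: "real set \<Rightarrow> (real \<Rightarrow> real) set" where
  "C_carrier I = {f \<in> extensional I. continuous_on I f}"

definition C_nbhd :: "real set \<Rightarrow> real set \<Rightarrow> real \<Rightarrow> (real \<Rightarrow> real) \<Rightarrow> (real \<Rightarrow> real) set" where
  "C_nbhd I K e f = {g \<in> C_carrier I. \<forall>t\<in>K. \<bar>g t - f t\<bar> < e}"

text \<open>The local uniform topology, i.e. uniform convergence on compact subsets of \<open>I\<close>.\<close>

definition C_topology :: "real set \<Rightarrow> (real \<Rightarrow> real) topology" where
  "C_topology I = topology_generated_by
     {C_nbhd I K e f | K e f. compact K \<and> K \<subseteq> I \<and> e > 0 \<and> f \<in> C_carrier I}"

definition C_borel :: "real set \<Rightarrow> (real \<Rightarrow> real) measure" where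
  "C_borel I = sigma (C_carrier I) {U. openin (C_topology I) U}"

lemma topspace_C_topology [simp]: "topspace (C_topology I) = C_carrier I"
proof -
  have "f \<in> C_nbhd I {} 1 f" if "f \<in> C_carrier I" for f
    using that by (simp add: C_nbhd_def)
  then have "C_carrier I \<subseteq> \<Union> {C_nbhd I K e f | K e f.
      compact K \<and> K \<subseteq> I \<and> e > 0 \<and> f \<in> C_carrier I}"
    by (force intro: exI[of _ "{}"] exI[of _ "1::real"])
  then show ?thesis
    unfolding C_topology_def topology_generated_by_topspace by (auto simp: C_nbhd_def)
qed

lemma space_C_borel [simp]: "space (C_borel I) = C_carrier I"
  unfolding C_borel_def by (rule space_measure_of) (use openin_subset in fastforce)

lemma sets_C_borel: "sets (C_borel I) = sigma_sets (C_carrier I) {U. openin (C_topology I) U}"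
  unfolding C_borel_def by (rule sets_measure_of) (use openin_subset in fastforce)

section \<open>Distributions on path space and singularity\<close>

text \<open>Discontinuous paths, which occur only on a null set for the processes considered, are
  replaced by the zero function. As that null set need not be measurable, the distribution is
  taken with respect to the completion of the underlying probability space.\<close>

definition path_on :: "real set \<Rightarrow> (real \<Rightarrow> 'a \<Rightarrow> real) \<Rightarrow> 'a \<Rightarrow> real \<Rightarrow> real" where
  "path_on I X \<omega> = (if continuous_on I (\<lambda>t. X t \<omega>) then (\<lambda>t\<in>I. X t \<omega>) else (\<lambda>t\<in>I. 0))"

definition path_distr ::
  "'a measure \<Rightarrow> real set \<Rightarrow> (real \<Rightarrow> 'a \<Rightarrow> real) \<Rightarrow> (real \<Rightarrow> real) measure" where
  "path_distr M I X = distr (completion M) (C_borel I) (path_on I X)"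

definition singular_on ::
  "real set \<Rightarrow> 'a measure \<Rightarrow> (real \<Rightarrow> 'a \<Rightarrow> real) \<Rightarrow> 'b measure \<Rightarrow> (real \<Rightarrow> 'b \<Rightarrow> real) \<Rightarrow> bool" where
  "singular_on I M1 X1 M2 X2 \<longleftrightarrow>
     (\<exists>A \<in> sets (C_borel I). emeasure (path_distr M1 I X1) A = 1 \<and> emeasure (path_distr M2 I X2) A = 0)"

end

theory Submission
  imports Defs
begin

text \<open>Cut \<open>[a, b] \<subseteq> I\<close> into \<open>N\<close> cells of length \<open>h\<close> and let \<open>Q\<close> be the sum of the squared increments of the
  path over \<open>[a + i h, a + i h + d]\<close>. For fixed \<open>N\<close> and \<open>d \<rightarrow> 0\<close> these increments decorrelate, so
  for small \<open>d\<close> Chebyshev's inequality with Isserlis' formula gives \<open>Q \<approx> N d^(2 H)\<close> up to a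
  factor in \<open>(1/2, 3/2)\<close>, with probability at least \<open>1 - 16/N\<close>. If moreover \<open>d^(2 (H2 - H1))\<close>
  lies outside \<open>[1/3, 3]\<close>, the event that \<open>Q\<close> is of size \<open>N d^(2 H1)\<close> separates the two laws up to
  \<open>16/N\<close>. Taking \<open>N = 2^n\<close>, the Borel--Cantelli lemma turns this into singularity. Since the
  path space is separable, its Borel sets are generated by the evaluations, so the path
  distributions are proper push-forward measures.\<close>

section \<open>Borel sets of the path space\<close>

lemma openin_C_nbhd:
  assumes "compact K" "K \<subseteq> I" "0 < e" "f \<in> C_carrier I"
  shows "openin (C_topology I) (C_nbhd I K e f)"
  unfolding C_topology_def openin_topology_generated_by_iff
  using assms by (intro generate_topology_on.Basis) blast

lemma sets_C_borel_open: "openin (C_topology I) U \<Longrightarrow> U \<in> sets (C_borel I)"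
  by (auto simp: sets_C_borel)

text \<open>The sets \<open>f t < r\<close> are open: around each member \<open>f\<close>, the basic
  neighbourhood over the compact set \<open>{t}\<close> with radius \<open>r - f t\<close> stays
  inside.\<close>

lemma measurable_C_eval:
  assumes "t \<in> I"
  shows "(\<lambda>f. f t) \<in> borel_measurable (C_borel I)"
proof (rule borel_measurableI_less)
  fix r :: real
  let ?A = "{f \<in> space (C_borel I). f t < r}"
  have "?A = (\<Union>f\<in>?A. C_nbhd I {t} (r - f t) f)"
    by (auto simp: C_nbhd_def abs_less_iff)
  moreover have "openin (C_topology I) (\<Union>f\<in>?A. C_nbhd I {t} (r - f t) f)"
    using assms by (intro openin_Union) (auto intro!: openin_C_nbhd)
  ultimately show "?A \<in> sets (C_borel I)"
    by (metis sets_C_borel_open)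
qed

text \<open>This yields a countable neighbourhood base at every point, with one index controlling
  both the compact set and the radius. The induction over the generated topology has one substantial
  case: a basic set whose centre differs from \<open>f\<close>.\<close>

lemma openin_C_topology_nbhd:
  assumes "openin (C_topology I) U" "f \<in> U"
  shows "\<exists>n::nat. C_nbhd I (I \<inter> {- real n..real n}) (1 / real (Suc n)) f \<subseteq> U"
proof -
  have mono: "C_nbhd I (I \<inter> {- real n..real n}) (1 / real (Suc n)) f
      \<subseteq> C_nbhd I (I \<inter> {- real m..real m}) (1 / real (Suc m)) f" if "m \<le> n" for m n f
  proof -
    have "1 / real (Suc n) \<le> 1 / real (Suc m)"
      using that by (simp add: frac_le)
    moreover have "I \<inter> {- real m..real m} \<subseteq> I \<inter> {- real n..real n}"
      using that by auto
    ultimately show ?thesis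
      unfolding C_nbhd_def by (smt (verit) Collect_mono subsetD)
  qed
  have "generate_topology_on {C_nbhd I K e f | K e f. compact K \<and> K \<subseteq> I \<and> e > 0 \<and> f \<in> C_carrier I} U"
    using assms(1) unfolding C_topology_def openin_topology_generated_by_iff .
  then show ?thesis using assms(2)
  proof (induction arbitrary: f)
    case (Int a b)
    then obtain m n where
      m: "C_nbhd I (I \<inter> {- real m..real m}) (1 / real (Suc m)) f \<subseteq> a" and
      n: "C_nbhd I (I \<inter> {- real n..real n}) (1 / real (Suc n)) f \<subseteq> b"
      by blast
    show ?case
      using m n mono[of m "max m n" f] mono[of n "max m n" f] by (intro exI[of _ "max m n"]) auto
  next
    case (UN V)
    then show ?case by (meson Union_iff Union_upper subset_trans)
  next
    case (Basis s)
    then obtain K e g where s: "s = C_nbhd I K e g" and K: "compact K" "K \<subseteq> I" "0 < e"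
      and g: "g \<in> C_carrier I" by blast
    have f: "f \<in> C_carrier I" "\<forall>t\<in>K. \<bar>f t - g t\<bar> < e"
      using Basis s by (auto simp: C_nbhd_def)
    have cont: "continuous_on K (\<lambda>t. \<bar>f t - g t\<bar>)"
      using f(1) g K(2) unfolding C_carrier_def
      by (auto intro!: continuous_intros intro: continuous_on_subset)
    \<comment> \<open>By compactness the distance from \<open>f\<close> to the centre
      \<open>g\<close> attains its maximum over \<open>K\<close>, so it stays below \<open>e\<close>
      by a uniform gap; \<open>e - m\<close> is the radius left around \<open>f\<close>.\<close>
    obtain m where m: "m < e" "\<forall>t\<in>K. \<bar>f t - g t\<bar> \<le> m"
    proof (cases "K = {}")
      case False
      from continuous_attains_sup[OF K(1) this cont] obtain t0
        where "t0 \<in> K" "\<forall>t\<in>K. \<bar>f t - g t\<bar> \<le> \<bar>f t0 - g t0\<bar>" by blast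
      with f(2) show ?thesis by (intro that[of "\<bar>f t0 - g t0\<bar>"]) auto
    next
      case True
      then show ?thesis using K(3) that[of 0] by simp
    qed
    obtain B where B: "\<forall>t\<in>K. \<bar>t\<bar> \<le> B"
      using compact_imp_bounded[OF K(1)] by (auto simp: bounded_iff)
    obtain n1 where n1: "B \<le> real n1" by (meson real_arch_simple)
    obtain n2 where n2: "1 / real (Suc n2) < e - m"
      using m(1) nat_approx_posE[of "e - m"] by auto
    define n where "n = max n1 n2"
    have "1 / real (Suc n) \<le> 1 / real (Suc n2)" unfolding n_def by (simp add: frac_le)
    then have n: "1 / real (Suc n) < e - m" using n2 by linarith
    have sub: "K \<subseteq> I \<inter> {- real n..real n}"
      using B K(2) n1 unfolding n_def by (force simp: abs_le_iff)
    have "h \<in> s" if h: "h \<in> C_nbhd I (I \<inter> {- real n..real n}) (1 / real (Suc n)) f" for h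
    proof -
      have "\<bar>h t - g t\<bar> < e" if "t \<in> K" for t
      proof -
        have "\<bar>h t - f t\<bar> < e - m"
        proof -
          have "\<bar>h t - f t\<bar> < 1 / real (Suc n)"
            using h subsetD[OF sub that] unfolding C_nbhd_def by blast
          then show ?thesis using n by linarith
        qed
        then show ?thesis using m(2) that by fastforce
      qed
      with h show ?thesis unfolding s C_nbhd_def by auto
    qed
    then show ?case by blast
  qed simp
qed

text \<open>The family consists of the polynomials with rational coefficients: Stone-Weierstrass
  gives a real polynomial, whose coefficients are then rounded. The same countable family serves
  every compact set.\<close>

lemma countable_uniformly_dense:
  obtains D :: "(real \<Rightarrow> real) set" where "countable D"
    "\<And>p. p \<in> D \<Longrightarrow> continuous_on UNIV p"
    "\<And>K f e. compact K \<Longrightarrow> continuous_on K f \<Longrightarrow> 0 < e \<Longrightarrow> \<exists>p\<in>D. \<forall>t\<in>K. \<bar>p t - f t\<bar> < e"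
proof
  define P :: "rat list \<Rightarrow> real \<Rightarrow> real"
    where "P l t = (\<Sum>i<length l. of_rat (l ! i) * t ^ i)" for l t
  show "countable (range P)" by simp
  show "continuous_on UNIV p" if "p \<in> range P" for p
    using that by (auto simp: P_def intro!: continuous_intros)
  show "\<exists>p\<in>range P. \<forall>t\<in>K. \<bar>p t - f t\<bar> < e"
    if K: "compact K" and f: "continuous_on K f" and e: "0 < e" for K e and f :: "real \<Rightarrow> real"
  proof -
    obtain g where g: "real_polynomial_function g" "\<And>t. t \<in> K \<Longrightarrow> \<bar>f t - g t\<bar> < e / 2"
      using Stone_Weierstrass_real_polynomial_function[OF K f, of "e/2"] e by auto
    then obtain a n where ga: "g = (\<lambda>x. \<Sum>i\<le>n. a i * x^i)"
      using real_polynomial_function_iff_sum by auto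
    obtain B where B: "\<forall>t\<in>K. \<bar>t\<bar> \<le> B" "1 \<le> B"
      using compact_imp_bounded[OF K] unfolding bounded_iff real_norm_def
      by (meson max.cobounded1 max.cobounded2 order_trans)
    \<comment> \<open>On \<open>K\<close>, rounding the \<open>n + 1\<close> coefficients by less
      than \<open>d\<close> costs at most \<open>(n + 1) * d * B ^ n = e / 2\<close>;
      \<open>1 \<le> B\<close> ensures that \<open>B ^ n\<close> dominates all lower powers.\<close>
    define d where "d = e / 2 / (real (Suc n) * B ^ n)"
    have d: "0 < d" using e B(2) unfolding d_def by simp
    have "\<exists>r::rat. \<bar>of_rat r - a i\<bar> < d" for i
      using of_rat_dense[of "a i - d" "a i + d"] d by (auto simp: abs_less_iff) (metis add.commute diff_less_eq minus_diff_eq neg_less_iff_less less_diff_eq)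
    then obtain r where r: "\<And>i. \<bar>real_of_rat (r i) - a i\<bar> < d" by metis
    define l where "l = map r [0..<Suc n]"
    have P: "P l t = (\<Sum>i\<le>n. of_rat (r i) * t ^ i)" for t
      unfolding P_def l_def by (simp del: upt_Suc add: lessThan_Suc_atMost)
    have "\<bar>P l t - f t\<bar> < e" if t: "t \<in> K" for t
    proof -
      have "\<bar>P l t - g t\<bar> = \<bar>\<Sum>i\<le>n. (of_rat (r i) - a i) * t ^ i\<bar>"
        unfolding P ga by (simp add: sum_subtractf algebra_simps)
      also have "\<dots> \<le> (\<Sum>i\<le>n. d * B ^ n)"
      proof (rule order_trans[OF sum_abs sum_mono])
        fix i assume "i \<in> {..n}"
        then have "\<bar>t\<bar> ^ i \<le> B ^ n"
          using B t by (meson atMost_iff abs_ge_zero order_trans power_increasing power_mono)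
        then show "\<bar>(of_rat (r i) - a i) * t ^ i\<bar> \<le> d * B ^ n"
          using less_imp_le[OF r[of i]] d by (simp add: abs_mult power_abs mult_mono)
      qed
      also have "\<dots> = (real (Suc n) * B ^ n) * d" by simp
      also have "\<dots> = e / 2" using B(2) unfolding d_def by (simp del: of_nat_Suc)
      finally show ?thesis using g(2)[OF t] by linarith
    qed
    then show ?thesis by blast
  qed
qed

text \<open>The condition is tested on a countable dense subset of the compact set, with a strict bound
  replaced by a uniform one.\<close>

lemma sets_uniform_bound:
  fixes F :: "'a \<Rightarrow> real \<Rightarrow> real"
  assumes K: "compact K" and F: "\<And>t. t \<in> K \<Longrightarrow> (\<lambda>\<omega>. F \<omega> t) \<in> borel_measurable N"
    and cont: "\<And>\<omega>. \<omega> \<in> space N \<Longrightarrow> continuous_on K (F \<omega>)"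
  shows "{\<omega> \<in> space N. \<forall>t\<in>K. \<bar>F \<omega> t\<bar> < e} \<in> sets N"
proof -
  obtain T where T: "countable T" "T \<subseteq> K" "K \<subseteq> closure T" by (rule separable)
  have "(\<forall>t\<in>K. \<bar>F \<omega> t\<bar> < e) \<longleftrightarrow> (\<exists>m. \<forall>t\<in>T. \<bar>F \<omega> t\<bar> \<le> e - 1 / real (Suc m))"
    if \<omega>: "\<omega> \<in> space N" for \<omega>
  proof
    assume L: "\<forall>t\<in>K. \<bar>F \<omega> t\<bar> < e"
    show "\<exists>m. \<forall>t\<in>T. \<bar>F \<omega> t\<bar> \<le> e - 1 / real (Suc m)"
    proof (cases "K = {}")
      case False
      have "continuous_on K (\<lambda>t. \<bar>F \<omega> t\<bar>)" using cont[OF \<omega>] by (intro continuous_intros)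
      from continuous_attains_sup[OF K False this] obtain t0
        where t0: "t0 \<in> K" "\<forall>t\<in>K. \<bar>F \<omega> t\<bar> \<le> \<bar>F \<omega> t0\<bar>" by blast
      then obtain m where "1 / real (Suc m) < e - \<bar>F \<omega> t0\<bar>"
        using L nat_approx_posE[of "e - \<bar>F \<omega> t0\<bar>"] by auto
      then show ?thesis using t0 T(2) by (intro exI[of _ m]) fastforce
    next
      case True
      then show ?thesis using T by auto
    qed
  next
    assume "\<exists>m. \<forall>t\<in>T. \<bar>F \<omega> t\<bar> \<le> e - 1 / real (Suc m)"
    then obtain m where m: "\<forall>t\<in>T. \<bar>F \<omega> t\<bar> \<le> e - 1 / real (Suc m)" by blast
    \<comment> \<open>The non-strict bound defines a closed set, so it passes from \<open>T\<close>
      to its closure, which contains \<open>K\<close>.\<close>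
    have "closed (K \<inter> (\<lambda>t. \<bar>F \<omega> t\<bar>) -` {..e - 1 / real (Suc m)})"
      using cont[OF \<omega>] compact_imp_closed[OF K]
      by (intro continuous_closed_preimage) (auto intro!: continuous_intros)
    then have "closure T \<subseteq> K \<inter> (\<lambda>t. \<bar>F \<omega> t\<bar>) -` {..e - 1 / real (Suc m)}"
      using m T(2) by (intro closure_minimal) auto
    then show "\<forall>t\<in>K. \<bar>F \<omega> t\<bar> < e"
      using T(3) by (smt (verit) IntD2 atMost_iff divide_pos_pos of_nat_0_less_iff subsetD vimageD zero_less_Suc)
  qed
  then have "{\<omega> \<in> space N. \<forall>t\<in>K. \<bar>F \<omega> t\<bar> < e}
      = {\<omega> \<in> space N. \<exists>m. \<forall>t\<in>T. \<bar>F \<omega> t\<bar> \<le> e - 1 / real (Suc m)}" by blast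
  also have "\<dots> \<in> sets N"
    using T F by (intro sets.sets_Collect_countable_Ex sets.sets_Collect_countable_All'
        borel_measurable_le borel_measurable_abs) auto
  finally show ?thesis .
qed

text \<open>Second countability: every open set is a countable union of sets \<open>C_nbhd\<close>
  centred at members of a countable dense family, and the preimage of each is described by a uniform
  bound over a compact set. The centres need not lie in \<open>C_carrier I\<close>, since
  \<open>C_nbhd\<close> restricts only its members.\<close>

lemma measurable_C_borel:
  assumes "closed I"
    and C: "\<And>\<omega>. \<omega> \<in> space N \<Longrightarrow> F \<omega> \<in> C_carrier I"
    and F: "\<And>t. t \<in> I \<Longrightarrow> (\<lambda>\<omega>. F \<omega> t) \<in> borel_measurable N"
  shows "F \<in> measurable N (C_borel I)"
  unfolding C_borel_def
proof (rule measurable_measure_of)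
  show "{U. openin (C_topology I) U} \<subseteq> Pow (C_carrier I)"
    using openin_subset by fastforce
  show "F \<in> space N \<rightarrow> C_carrier I" using C by blast
  fix U assume "U \<in> {U. openin (C_topology I) U}"
  then have U: "openin (C_topology I) U" by simp
  obtain D :: "(real \<Rightarrow> real) set" where D: "countable D"
    "\<And>p. p \<in> D \<Longrightarrow> continuous_on UNIV p"
    "\<And>K f e. compact K \<Longrightarrow> continuous_on K f \<Longrightarrow> 0 < e \<Longrightarrow> \<exists>p\<in>D. \<forall>t\<in>K. \<bar>p t - f t\<bar> < e"
    using countable_uniformly_dense by blast
  define K where "K n = I \<inter> {- real n..real n}" for n :: nat
  \<comment> \<open>Half of the radius around \<open>f\<close>, so that the triangle inequality
    through the centre \<open>p\<close> stays within \<open>1 / (n + 1)\<close>.\<close>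
  define e where "e n = 1 / real (Suc n) / 2" for n :: nat
  have K: "compact (K n)" for n
    unfolding K_def using \<open>closed I\<close> by (intro closed_Int_compact) auto
  define J where "J = {(p, n). p \<in> D \<and> C_nbhd I (K n) (e n) p \<subseteq> U}"
  have "countable J"
    by (rule countable_subset[of _ "D \<times> UNIV"]) (use D(1) in \<open>auto simp: J_def\<close>)
  have UJ: "U = (\<Union>(p, n)\<in>J. C_nbhd I (K n) (e n) p)"
  proof (intro equalityI subsetI)
    fix f assume f: "f \<in> U"
    then have fC: "f \<in> C_carrier I" using openin_subset[OF U] by auto
    obtain n where n: "C_nbhd I (K n) (1 / real (Suc n)) f \<subseteq> U"
      using openin_C_topology_nbhd[OF U f] unfolding K_def by blast
    have "continuous_on (K n) f"
      using fC unfolding C_carrier_def K_def by (auto intro: continuous_on_subset)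
    then obtain p where p: "p \<in> D" "\<forall>t\<in>K n. \<bar>p t - f t\<bar> < e n"
      using D(3)[OF K, of n f "e n"] unfolding e_def by auto
    have "C_nbhd I (K n) (e n) p \<subseteq> C_nbhd I (K n) (1 / real (Suc n)) f"
    proof
      fix h assume h: "h \<in> C_nbhd I (K n) (e n) p"
      have "\<bar>h t - f t\<bar> < 1 / real (Suc n)" if "t \<in> K n" for t
      proof -
        have "\<bar>h t - p t\<bar> < e n" using h that unfolding C_nbhd_def by blast
        moreover have "\<bar>p t - f t\<bar> < e n" using p that by blast
        moreover have "1 / real (Suc n) = e n + e n" unfolding e_def by (rule field_sum_of_halves[symmetric])
        ultimately show ?thesis by linarith
      qed
      then show "h \<in> C_nbhd I (K n) (1 / real (Suc n)) f"
        using h unfolding C_nbhd_def by auto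
    qed
    then have "(p, n) \<in> J" using p n unfolding J_def by auto
    moreover have "f \<in> C_nbhd I (K n) (e n) p"
      using p fC by (auto simp: C_nbhd_def abs_minus_commute)
    ultimately show "f \<in> (\<Union>(p, n)\<in>J. C_nbhd I (K n) (e n) p)" by blast
  qed (auto simp: J_def)
  have "F -` U \<inter> space N = (\<Union>(p, n)\<in>J. {\<omega> \<in> space N. \<forall>t\<in>K n. \<bar>F \<omega> t - p t\<bar> < e n})"
    unfolding UJ C_nbhd_def using C by auto
  also have "\<dots> \<in> sets N"
  proof (rule sets.countable_UN'[OF \<open>countable J\<close>], clarify)
    fix p n assume "(p, n) \<in> J"
    then have p: "continuous_on UNIV p" using D(2) by (auto simp: J_def)
    show "{\<omega> \<in> space N. \<forall>t\<in>K n. \<bar>F \<omega> t - p t\<bar> < e n} \<in> sets N"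
    proof (rule sets_uniform_bound[OF K])
      show "(\<lambda>\<omega>. F \<omega> t - p t) \<in> borel_measurable N" if "t \<in> K n" for t
        using F[of t] that by (auto simp: K_def)
      show "continuous_on (K n) (\<lambda>t. F \<omega> t - p t)" if "\<omega> \<in> space N" for \<omega>
        using C[OF that] p unfolding C_carrier_def K_def
        by (auto intro!: continuous_intros intro: continuous_on_subset)
    qed
  qed
  finally show "F -` U \<inter> space N \<in> sets N" .
qed

section \<open>Measurability of the path map on the completed probability space\<close>

lemma path_on_in_C_carrier: "path_on I X \<omega> \<in> C_carrier I"
proof (cases "continuous_on I (\<lambda>t. X t \<omega>)")
  case True
  then have "continuous_on I (\<lambda>t\<in>I. X t \<omega>)" by (rule continuous_on_eq) simp
  with True show ?thesis by (simp add: path_on_def C_carrier_def)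
next
  case False
  have "continuous_on I (\<lambda>t\<in>I. 0 :: real)" by (rule continuous_on_eq[of _ "\<lambda>_. 0"]) auto
  with False show ?thesis by (simp add: path_on_def C_carrier_def)
qed

lemma AE_path_on_eq:
  assumes "continuous_paths_on M I X"
  shows "AE \<omega> in M. \<forall>t\<in>I. path_on I X \<omega> t = X t \<omega>"
  using assms unfolding continuous_paths_on_def by eventually_elim (simp add: path_on_def)

text \<open>The set where the two functions differ lies in a null set, and every subset of a null
  set is measurable in the completion.\<close>

lemma measurable_completion_AE:
  fixes f g :: "'a \<Rightarrow> real"
  assumes [measurable]: "f \<in> borel_measurable M" and ae: "AE \<omega> in M. g \<omega> = f \<omega>"
  shows "g \<in> borel_measurable (completion M)"
proof (rule measurableI)
  fix B :: "real set" assume B: "B \<in> sets borel"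
  have *: "{\<omega> \<in> space (completion M). f \<omega> \<in> B} \<in> sets (completion M)"
    using B measurable_completion[OF assms(1)] by measurable
  show "g -` B \<inter> space (completion M) \<in> sets (completion M)"
    by (rule completion.in_sets_AE[OF _ *])
      (use AE_completion[OF ae] in \<open>auto elim: eventually_mono\<close>)
qed simp

text \<open>Each evaluation of \<open>path_on\<close> agrees almost surely with \<open>X t\<close>,
  hence is measurable for the completion, and evaluations determine measurability into the path
  space.\<close>

lemma measurable_path_on:
  assumes "closed I" and X: "\<And>t. t \<in> I \<Longrightarrow> X t \<in> borel_measurable M"
    and "continuous_paths_on M I X"
  shows "path_on I X \<in> measurable (completion M) (C_borel I)"
proof (rule measurable_C_borel[OF \<open>closed I\<close> path_on_in_C_carrier])
  fix t assume t: "t \<in> I"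
  show "(\<lambda>\<omega>. path_on I X \<omega> t) \<in> borel_measurable (completion M)"
    by (rule measurable_completion_AE[OF X[OF t]])
      (use AE_path_on_eq[OF assms(3)] t in \<open>auto elim: eventually_mono\<close>)
qed

section \<open>Sums of squares of weakly correlated Gaussian variables\<close>

text \<open>There are two cases: a density, where the even moments of the normal law give
  \<open>\<sigma>^2\<close> and \<open>3 * \<sigma>^4\<close>, and a constant, which mean zero
  forces to vanish almost surely.\<close>

lemma gaussian_rv_mean_zero_moments:
  assumes "prob_space M" and Y: "gaussian_rv M Y" and mean: "(\<integral>\<omega>. Y \<omega> \<partial>M) = 0"
  shows "integrable M Y" "integrable M (\<lambda>\<omega>. Y \<omega> ^ 4)"
    "(\<integral>\<omega>. Y \<omega> ^ 4 \<partial>M) = 3 * (\<integral>\<omega>. Y \<omega> ^ 2 \<partial>M)\<^sup>2"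
proof -
  interpret prob_space M by fact
  have [measurable]: "Y \<in> borel_measurable M" using Y unfolding gaussian_rv_def by blast
  consider \<mu> \<sigma> where "\<sigma> > 0" "distributed M lborel Y (normal_density \<mu> \<sigma>)"
    | \<mu> where "AE \<omega> in M. Y \<omega> = \<mu>"
    using Y unfolding gaussian_rv_def by blast
  then have "integrable M Y \<and> integrable M (\<lambda>\<omega>. Y \<omega> ^ 4) \<and>
    (\<integral>\<omega>. Y \<omega> ^ 4 \<partial>M) = 3 * (\<integral>\<omega>. Y \<omega> ^ 2 \<partial>M)\<^sup>2"
  proof cases
    case 1
    note D = 1(2)
    have "\<mu> = 0" using normal_distributed_expectation[OF 1] mean by simp
    with D have D: "distributed M lborel Y (normal_density 0 \<sigma>)" by simp
    have int: "integrable M (\<lambda>\<omega>. Y \<omega> ^ k)" for k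
      using distributed_integrable[OF D, of "\<lambda>x. x ^ k"] integrable_normal_moment[OF 1(1), of 0 k]
      by simp
    have mom: "(\<integral>\<omega>. Y \<omega> ^ (2 * k) \<partial>M) = fact (2 * k) / ((2 / \<sigma>\<^sup>2) ^ k * fact k)" for k
      using distributed_integral[OF D, of "\<lambda>x. x ^ (2 * k)"]
        integral_normal_moment_even[OF 1(1), of 0 k] by simp
    have "(\<integral>\<omega>. Y \<omega> ^ 2 \<partial>M) = \<sigma>\<^sup>2"
      using mom[of 1] by (simp add: power2_eq_square)
    moreover have "(\<integral>\<omega>. Y \<omega> ^ 4 \<partial>M) = 3 * (\<sigma>\<^sup>2)\<^sup>2"
      using mom[of 2] by (simp add: fact_numeral field_simps)
    ultimately show ?thesis using int[of 1] int[of 4] by simp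
  next
    case 2
    have "(\<integral>\<omega>. Y \<omega> \<partial>M) = (\<integral>\<omega>. \<mu> \<partial>M)" using 2 by (intro integral_cong_AE) auto
    then have ae: "AE \<omega> in M. Y \<omega> = 0" using 2 mean by (simp add: prob_space)
    have pow: "integrable M (\<lambda>\<omega>. Y \<omega> ^ k) \<and> (\<integral>\<omega>. Y \<omega> ^ k \<partial>M) = 0" if "0 < k" for k
    proof -
      have *: "AE \<omega> in M. Y \<omega> ^ k = 0" using ae by eventually_elim (simp add: that)
      have "integrable M (\<lambda>\<omega>. Y \<omega> ^ k) \<longleftrightarrow> integrable M (\<lambda>_. 0 :: real)"
        by (rule integrable_cong_AE[OF _ _ *]) auto
      moreover have "(\<integral>\<omega>. Y \<omega> ^ k \<partial>M) = (\<integral>\<omega>. 0 \<partial>M)"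
        by (rule integral_cong_AE[OF _ _ *]) auto
      ultimately show ?thesis by simp
    qed
    show ?thesis using pow[of 1] pow[of 2] pow[of 4] by simp
  qed
  then show "integrable M Y" "integrable M (\<lambda>\<omega>. Y \<omega> ^ 4)"
    "(\<integral>\<omega>. Y \<omega> ^ 4 \<partial>M) = 3 * (\<integral>\<omega>. Y \<omega> ^ 2 \<partial>M)\<^sup>2" by blast+
qed

definition centred_gaussian :: "'a measure \<Rightarrow> ('a \<Rightarrow> real) \<Rightarrow> bool" where
  "centred_gaussian M Y \<longleftrightarrow> gaussian_rv M Y \<and> (\<integral>\<omega>. Y \<omega> \<partial>M) = 0"

text \<open>Domination by \<open>2 * |y z| \<le> y^2 + z^2\<close>. It serves both for a product of
  Gaussian variables and for a product of their squares, where the hypotheses become fourth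
  moments.\<close>

lemma integrable_mult_of_squares:
  fixes Y Z :: "'a \<Rightarrow> real"
  assumes "Y \<in> borel_measurable M" "Z \<in> borel_measurable M"
    and "integrable M (\<lambda>\<omega>. (Y \<omega>)\<^sup>2)" "integrable M (\<lambda>\<omega>. (Z \<omega>)\<^sup>2)"
  shows "integrable M (\<lambda>\<omega>. Y \<omega> * Z \<omega>)"
proof (rule Bochner_Integration.integrable_bound)
  show "integrable M (\<lambda>\<omega>. (Y \<omega>)\<^sup>2 + (Z \<omega>)\<^sup>2)" using assms by simp
  show "(\<lambda>\<omega>. Y \<omega> * Z \<omega>) \<in> borel_measurable M" using assms by simp
  show "AE \<omega> in M. norm (Y \<omega> * Z \<omega>) \<le> norm ((Y \<omega>)\<^sup>2 + (Z \<omega>)\<^sup>2)"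
  proof (rule AE_I2)
    fix \<omega>
    have "2 * \<bar>Y \<omega> * Z \<omega>\<bar> \<le> (Y \<omega>)\<^sup>2 + (Z \<omega>)\<^sup>2"
      using sum_squares_bound[of "\<bar>Y \<omega>\<bar>" "\<bar>Z \<omega>\<bar>"] by (simp add: abs_mult mult.assoc)
    then show "norm (Y \<omega> * Z \<omega>) \<le> norm ((Y \<omega>)\<^sup>2 + (Z \<omega>)\<^sup>2)"
      by (smt (verit) abs_ge_zero real_norm_def)
  qed
qed

text \<open>Polarisation: \<open>(y + z)^4 + (y - z)^4 = 2 y^4 + 12 y^2 z^2 + 2 z^4\<close> reduces the mixed
  moment to fourth moments of Gaussian variables.\<close>

lemma isserlis_squares:
  assumes "prob_space M"
    and Y: "centred_gaussian M Y" and Z: "centred_gaussian M Z"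
    and S: "centred_gaussian M (\<lambda>\<omega>. Y \<omega> + Z \<omega>)" and D: "centred_gaussian M (\<lambda>\<omega>. Y \<omega> - Z \<omega>)"
  shows "integrable M (\<lambda>\<omega>. (Y \<omega>)\<^sup>2)" "integrable M (\<lambda>\<omega>. (Y \<omega>)\<^sup>2 * (Z \<omega>)\<^sup>2)"
    "(\<integral>\<omega>. (Y \<omega>)\<^sup>2 * (Z \<omega>)\<^sup>2 \<partial>M) =
      (\<integral>\<omega>. (Y \<omega>)\<^sup>2 \<partial>M) * (\<integral>\<omega>. (Z \<omega>)\<^sup>2 \<partial>M) + 2 * (\<integral>\<omega>. Y \<omega> * Z \<omega> \<partial>M)\<^sup>2"
proof -
  interpret prob_space M by fact
  have [measurable]: "Y \<in> borel_measurable M" "Z \<in> borel_measurable M"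
    using Y Z unfolding centred_gaussian_def gaussian_rv_def by blast+
  note m = gaussian_rv_mean_zero_moments[OF \<open>prob_space M\<close>]
  have i4: "integrable M (\<lambda>\<omega>. Y \<omega> ^ 4)" "integrable M (\<lambda>\<omega>. Z \<omega> ^ 4)"
      "integrable M (\<lambda>\<omega>. (Y \<omega> + Z \<omega>) ^ 4)" "integrable M (\<lambda>\<omega>. (Y \<omega> - Z \<omega>) ^ 4)"
    and e4: "(\<integral>\<omega>. Y \<omega> ^ 4 \<partial>M) = 3 * (\<integral>\<omega>. (Y \<omega>)\<^sup>2 \<partial>M)\<^sup>2"
      "(\<integral>\<omega>. Z \<omega> ^ 4 \<partial>M) = 3 * (\<integral>\<omega>. (Z \<omega>)\<^sup>2 \<partial>M)\<^sup>2"
      "(\<integral>\<omega>. (Y \<omega> + Z \<omega>) ^ 4 \<partial>M) = 3 * (\<integral>\<omega>. (Y \<omega> + Z \<omega>)\<^sup>2 \<partial>M)\<^sup>2"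
      "(\<integral>\<omega>. (Y \<omega> - Z \<omega>) ^ 4 \<partial>M) = 3 * (\<integral>\<omega>. (Y \<omega> - Z \<omega>)\<^sup>2 \<partial>M)\<^sup>2"
    using Y Z S D m unfolding centred_gaussian_def by blast+
  have i44: "integrable M (\<lambda>\<omega>. ((Y \<omega>)\<^sup>2)\<^sup>2)" "integrable M (\<lambda>\<omega>. ((Z \<omega>)\<^sup>2)\<^sup>2)"
    using i4(1,2) by (simp_all flip: power_mult)
  have i2: "integrable M (\<lambda>\<omega>. (Y \<omega>)\<^sup>2)" "integrable M (\<lambda>\<omega>. (Z \<omega>)\<^sup>2)"
    using i44 by (auto intro: square_integrable_imp_integrable)
  have iYZ: "integrable M (\<lambda>\<omega>. Y \<omega> * Z \<omega>)"
    by (rule integrable_mult_of_squares) (auto intro: i2)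
  show "integrable M (\<lambda>\<omega>. (Y \<omega>)\<^sup>2)" by fact
  show iYYZZ: "integrable M (\<lambda>\<omega>. (Y \<omega>)\<^sup>2 * (Z \<omega>)\<^sup>2)"
    using i44 by (intro integrable_mult_of_squares) auto
  let ?s = "\<integral>\<omega>. (Y \<omega>)\<^sup>2 \<partial>M" and ?t = "\<integral>\<omega>. (Z \<omega>)\<^sup>2 \<partial>M" and ?c = "\<integral>\<omega>. Y \<omega> * Z \<omega> \<partial>M"
  have plus: "(\<integral>\<omega>. (Y \<omega> + Z \<omega>)\<^sup>2 \<partial>M) = ?s + ?t + 2 * ?c"
  proof -
    have "(\<integral>\<omega>. (Y \<omega> + Z \<omega>)\<^sup>2 \<partial>M) = (\<integral>\<omega>. (Y \<omega>)\<^sup>2 + (Z \<omega>)\<^sup>2 + 2 * (Y \<omega> * Z \<omega>) \<partial>M)"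
      by (simp only: power2_sum mult.assoc)
    also have "\<dots> = ?s + ?t + 2 * ?c" using i2 iYZ by simp
    finally show ?thesis .
  qed
  have minus: "(\<integral>\<omega>. (Y \<omega> - Z \<omega>)\<^sup>2 \<partial>M) = ?s + ?t - 2 * ?c"
  proof -
    have "(\<integral>\<omega>. (Y \<omega> - Z \<omega>)\<^sup>2 \<partial>M) = (\<integral>\<omega>. (Y \<omega>)\<^sup>2 + (Z \<omega>)\<^sup>2 - 2 * (Y \<omega> * Z \<omega>) \<partial>M)"
      by (simp only: power2_diff mult.assoc)
    also have "\<dots> = ?s + ?t - 2 * ?c" using i2 iYZ by simp
    finally show ?thesis .
  qed
  have "12 * (\<integral>\<omega>. (Y \<omega>)\<^sup>2 * (Z \<omega>)\<^sup>2 \<partial>M) = (\<integral>\<omega>. 12 * ((Y \<omega>)\<^sup>2 * (Z \<omega>)\<^sup>2) \<partial>M)"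
    by simp
  also have "\<dots> = (\<integral>\<omega>. (Y \<omega> + Z \<omega>) ^ 4 + (Y \<omega> - Z \<omega>) ^ 4 - 2 * Y \<omega> ^ 4 - 2 * Z \<omega> ^ 4 \<partial>M)"
    by (intro Bochner_Integration.integral_cong refl) (simp add: power2_eq_square power4_eq_xxxx algebra_simps)
  also have "\<dots> = 3 * (?s + ?t + 2 * ?c)\<^sup>2 + 3 * (?s + ?t - 2 * ?c)\<^sup>2 - 6 * ?s\<^sup>2 - 6 * ?t\<^sup>2"
  proof -
    have "(\<integral>\<omega>. (Y \<omega> + Z \<omega>) ^ 4 + (Y \<omega> - Z \<omega>) ^ 4 - 2 * Y \<omega> ^ 4 - 2 * Z \<omega> ^ 4 \<partial>M) =
      (\<integral>\<omega>. (Y \<omega> + Z \<omega>) ^ 4 \<partial>M) + (\<integral>\<omega>. (Y \<omega> - Z \<omega>) ^ 4 \<partial>M)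
        - 2 * (\<integral>\<omega>. Y \<omega> ^ 4 \<partial>M) - 2 * (\<integral>\<omega>. Z \<omega> ^ 4 \<partial>M)"
      using i4 by simp
    then show ?thesis unfolding e4 plus minus by simp
  qed
  also have "\<dots> = 12 * (?s * ?t + 2 * ?c\<^sup>2)" by (simp add: power2_eq_square algebra_simps)
  finally show "(\<integral>\<omega>. (Y \<omega>)\<^sup>2 * (Z \<omega>)\<^sup>2 \<partial>M) = ?s * ?t + 2 * ?c\<^sup>2" by simp
qed

text \<open>By Isserlis' formula the variance of the sum is twice the sum of all squared
  covariances. The diagonal gives \<open>2 * N * v^2\<close>, and the bound \<open>v / N\<close>
  keeps the other terms, fewer than \<open>N^2\<close>, below \<open>2 * v^2\<close> in total.
  Chebyshev's inequality at deviation \<open>N * v / 2\<close> then leaves a probability of order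
  \<open>1 / N\<close>.\<close>

lemma sum_squares_concentration:
  fixes N :: nat and v :: real
  assumes "prob_space M"
    and G: "\<And>i. i < N \<Longrightarrow> centred_gaussian M (Y i)"
    and Gp: "\<And>i j. i < N \<Longrightarrow> j < N \<Longrightarrow> centred_gaussian M (\<lambda>\<omega>. Y i \<omega> + Y j \<omega>)"
    and Gm: "\<And>i j. i < N \<Longrightarrow> j < N \<Longrightarrow> centred_gaussian M (\<lambda>\<omega>. Y i \<omega> - Y j \<omega>)"
    and v: "\<And>i. i < N \<Longrightarrow> (\<integral>\<omega>. (Y i \<omega>)\<^sup>2 \<partial>M) = v" and "0 < v"
    and corr: "\<And>i j. i < N \<Longrightarrow> j < N \<Longrightarrow> i \<noteq> j \<Longrightarrow> \<bar>\<integral>\<omega>. Y i \<omega> * Y j \<omega> \<partial>M\<bar> \<le> v / N"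
    and "0 < N"
  shows "measure M {\<omega> \<in> space M. N / 2 \<le> \<bar>(\<Sum>i<N. (Y i \<omega>)\<^sup>2) / v - N\<bar>} \<le> 16 / N"
proof -
  interpret prob_space M by fact
  have meas[measurable]: "Y i \<in> borel_measurable M" if "i < N" for i
    using G[OF that] unfolding centred_gaussian_def gaussian_rv_def by blast
  note iss = isserlis_squares[OF \<open>prob_space M\<close> G G Gp Gm]
  let ?S = "\<lambda>\<omega>. \<Sum>i<N. (Y i \<omega>)\<^sup>2"
  have i2: "integrable M (\<lambda>\<omega>. (Y i \<omega>)\<^sup>2)" if "i < N" for i using iss(1)[of i i] that by blast
  have ES: "expectation ?S = N * v" using i2 v by simp
  have sq: "(?S \<omega>)\<^sup>2 = (\<Sum>i<N. \<Sum>j<N. (Y i \<omega>)\<^sup>2 * (Y j \<omega>)\<^sup>2)" for \<omega>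
    by (simp add: power2_eq_square sum_product)
  have iS2: "integrable M (\<lambda>\<omega>. (?S \<omega>)\<^sup>2)"
    unfolding sq using iss(2) by (intro Bochner_Integration.integrable_sum) auto
  let ?c = "\<lambda>i j. \<integral>\<omega>. Y i \<omega> * Y j \<omega> \<partial>M"
  \<comment> \<open>The term \<open>1 / N^2\<close> is allowed on the diagonal as well, so that the
    double sum evaluates to \<open>v^2 * (N + 1)\<close> without treating \<open>i = j\<close>
    apart.\<close>
  have c: "(?c i j)\<^sup>2 \<le> v\<^sup>2 * ((if i = j then 1 else 0) + 1 / N\<^sup>2)" if "i < N" "j < N" for i j
  proof (cases "i = j")
    case True
    have "v\<^sup>2 * 1 \<le> v\<^sup>2 * (1 + 1 / N\<^sup>2)" by (intro mult_left_mono) auto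
    with True show ?thesis using v[OF that(1)] by (simp add: power2_eq_square)
  next
    case False
    have "(?c i j)\<^sup>2 \<le> (v / N)\<^sup>2"
      using corr[OF that False] by (metis abs_ge_zero power2_abs power_mono)
    with False show ?thesis by (simp add: power_divide)
  qed
  have "expectation (\<lambda>\<omega>. (?S \<omega>)\<^sup>2) = (\<Sum>i<N. \<Sum>j<N. v * v + 2 * (?c i j)\<^sup>2)"
  proof -
    have "expectation (\<lambda>\<omega>. (?S \<omega>)\<^sup>2) =
        (\<Sum>i<N. expectation (\<lambda>\<omega>. \<Sum>j<N. (Y i \<omega>)\<^sup>2 * (Y j \<omega>)\<^sup>2))"
      unfolding sq by (rule Bochner_Integration.integral_sum) (auto intro!: iss(2))
    also have "\<dots> = (\<Sum>i<N. \<Sum>j<N. v * v + 2 * (?c i j)\<^sup>2)"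
    proof (rule sum.cong[OF refl])
      fix i assume i: "i \<in> {..<N}"
      have "expectation (\<lambda>\<omega>. \<Sum>j<N. (Y i \<omega>)\<^sup>2 * (Y j \<omega>)\<^sup>2) =
          (\<Sum>j<N. expectation (\<lambda>\<omega>. (Y i \<omega>)\<^sup>2 * (Y j \<omega>)\<^sup>2))"
        using i by (intro Bochner_Integration.integral_sum iss(2)) auto
      also have "\<dots> = (\<Sum>j<N. v * v + 2 * (?c i j)\<^sup>2)"
        using i iss(3) v by (intro sum.cong) auto
      finally show "expectation (\<lambda>\<omega>. \<Sum>j<N. (Y i \<omega>)\<^sup>2 * (Y j \<omega>)\<^sup>2) =
          (\<Sum>j<N. v * v + 2 * (?c i j)\<^sup>2)" .
    qed
    finally show ?thesis .
  qed
  also have "\<dots> = (N * v)\<^sup>2 + 2 * (\<Sum>i<N. \<Sum>j<N. (?c i j)\<^sup>2)"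
    by (simp add: sum.distrib sum_distrib_left power2_eq_square)
  also have "(\<Sum>i<N. \<Sum>j<N. (?c i j)\<^sup>2)
      \<le> (\<Sum>i<N. \<Sum>j<N. v\<^sup>2 * ((if i = j then 1 else 0) + 1 / N\<^sup>2))"
    using c by (intro sum_mono) auto
  also have "\<dots> = v\<^sup>2 * (N + 1)"
  proof -
    have "real N * (1 + 1 / real N) = N + 1" using \<open>0 < N\<close> by (simp add: field_simps)
    then show ?thesis by (simp add: sum_distrib_left[symmetric] sum.distrib power2_eq_square)
  qed
  finally have "expectation (\<lambda>\<omega>. (?S \<omega>)\<^sup>2) \<le> (N * v)\<^sup>2 + 2 * (v\<^sup>2 * (N + 1))" by simp
  moreover have "variance ?S = expectation (\<lambda>\<omega>. (?S \<omega>)\<^sup>2) - (expectation ?S)\<^sup>2"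
    using i2 iS2 by (intro variance_eq) auto
  ultimately have var: "variance ?S \<le> 2 * (v\<^sup>2 * (N + 1))" using ES by simp
  have "{\<omega> \<in> space M. N / 2 \<le> \<bar>?S \<omega> / v - N\<bar>} = {\<omega> \<in> space M. N * v / 2 \<le> \<bar>?S \<omega> - expectation ?S\<bar>}"
  proof -
    have "\<bar>x / v - N\<bar> = \<bar>x - N * v\<bar> / v" for x
      using \<open>0 < v\<close> by (simp add: abs_if field_simps)
    then show ?thesis using \<open>0 < v\<close> ES by (auto simp: field_simps)
  qed
  then have "prob {\<omega> \<in> space M. N / 2 \<le> \<bar>?S \<omega> / v - N\<bar>} \<le> variance ?S / (N * v / 2)\<^sup>2"
    using Chebyshev_inequality[of ?S "N * v / 2"] iS2 \<open>0 < v\<close> \<open>0 < N\<close> by simp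
  also have "\<dots> \<le> 2 * (v\<^sup>2 * (N + 1)) / (N * v / 2)\<^sup>2"
    using var by (rule divide_right_mono) simp
  also have "\<dots> = 8 * (N + 1) / N\<^sup>2"
    using \<open>0 < v\<close> \<open>0 < N\<close> by (simp add: power_divide power_mult_distrib)
  \<comment> \<open>Here \<open>N + 1 \<le> 2 * N\<close>, as \<open>N\<close> is positive.\<close>
  also have "\<dots> \<le> 16 / N"
    using \<open>0 < N\<close> by (simp add: divide_simps power2_eq_square)
  finally show ?thesis .
qed

text \<open>The mean value theorem, applied twice.\<close>

lemma second_difference_powr:
  fixes s d p :: real
  assumes "0 < d" "d < s" "0 < p" "p < 2"
  shows "\<bar>(s + d) powr p + (s - d) powr p - 2 * s powr p\<bar> \<le> 4 * d\<^sup>2 * (s - d) powr (p - 2)"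
proof -
  \<comment> \<open>The backward difference; its increment from \<open>s\<close> to
    \<open>s + d\<close> is the second difference in question. As \<open>d < s\<close>, the point
    \<open>x - d\<close> stays positive for all \<open>x \<ge> s\<close>.\<close>
  define g where "g x = x powr p - (x - d) powr p" for x :: real
  have 1: "(g has_real_derivative p * x powr (p - 1) - p * (x - d) powr (p - 1)) (at x)"
    if "s \<le> x" for x
    unfolding g_def using that assms by (auto intro!: derivative_eq_intros)
  obtain z where z: "s < z" "z < s + d"
    "g (s + d) - g s = (s + d - s) * (p * z powr (p - 1) - p * (z - d) powr (p - 1))"
    using MVT2[of s "s + d" g, OF _ 1] assms by auto
  have 2: "((\<lambda>x. x powr (p - 1)) has_real_derivative (p - 1) * x powr (p - 1 - 1)) (at x)"
    if "z - d \<le> x" for x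
    using that assms z by (auto intro!: derivative_eq_intros)
  obtain y where y: "z - d < y" "y < z"
    "z powr (p - 1) - (z - d) powr (p - 1) = (z - (z - d)) * ((p - 1) * y powr (p - 1 - 1))"
    using MVT2[of "z - d" z "\<lambda>x. x powr (p - 1)", OF _ 2] assms by auto
  have "(s + d) powr p + (s - d) powr p - 2 * s powr p = g (s + d) - g s"
    unfolding g_def by simp
  also have "\<dots> = d\<^sup>2 * (p * (p - 1)) * y powr (p - 2)"
    unfolding z(3) right_diff_distrib[symmetric] y(3) by (simp add: power2_eq_square)
  finally have "\<bar>(s + d) powr p + (s - d) powr p - 2 * s powr p\<bar> = d\<^sup>2 * \<bar>p * (p - 1)\<bar> * y powr (p - 2)"
    by (simp add: abs_mult)
  \<comment> \<open>Crudely \<open>|p * (p - 1)| \<le> 2 * 2\<close>; moreover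
    \<open>s - d < z - d < y\<close> and the exponent \<open>p - 2\<close> is negative, so the power
    at \<open>y\<close> is at most the one at \<open>s - d\<close>.\<close>
  also have "\<dots> \<le> d\<^sup>2 * 4 * (s - d) powr (p - 2)"
  proof (intro mult_mono)
    have "\<bar>p\<bar> * \<bar>p - 1\<bar> \<le> 2 * 2" using assms by (intro mult_mono) auto
    then show "\<bar>p * (p - 1)\<bar> \<le> 4" by (simp add: abs_mult)
    show "y powr (p - 2) \<le> (s - d) powr (p - 2)"
      using y z assms by (intro powr_mono2') auto
  qed auto
  finally show ?thesis by (simp add: mult_ac)
qed

section \<open>Increments of fractional Brownian motion\<close>

text \<open>Two increments form one linear combination of at most four values of the process. Taking
  \<open>r = 1\<close> gives sums, exchanging \<open>c\<close> and \<open>d\<close> then gives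
  differences, and \<open>r = 0\<close> or \<open>c = d\<close> leaves a single increment.\<close>

lemma fbm_centred:
  assumes fbm: "fractional_brownian_motion M H X" and nonneg: "0 \<le> a" "0 \<le> b" "0 \<le> c" "0 \<le> d"
  shows "centred_gaussian M (\<lambda>\<omega>. (X a \<omega> - X b \<omega>) + r * (X c \<omega> - X d \<omega>))"
proof -
  have gp: "prob_space M"
    "\<And>S c. finite S \<Longrightarrow> S \<subseteq> {0..} \<Longrightarrow> gaussian_rv M (\<lambda>\<omega>. \<Sum>t\<in>S. c t * X t \<omega>)"
    and mean: "\<And>t. 0 \<le> t \<Longrightarrow> (\<integral>\<omega>. X t \<omega> \<partial>M) = 0"
    using fbm unfolding fractional_brownian_motion_def gaussian_process_def by blast+
  have int: "integrable M (X t)" if "0 \<le> t" for t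
    using gaussian_rv_mean_zero_moments(1)[OF gp(1) _ mean[OF that]] gp(2)[of "{t}" "\<lambda>_. 1"] that by simp
  define S where "S = {a, b, c, d}"
  \<comment> \<open>The four times may coincide, making \<open>S\<close> smaller; adding indicators
    gives the correct coefficient in every case.\<close>
  define k where "k t = ((if t = a then 1 else 0) - (if t = b then 1 else 0))
    + r * ((if t = c then 1 else 0) - (if t = d then 1 else 0))" for t
  have "(\<Sum>t\<in>S. k t * X t \<omega>) = (X a \<omega> - X b \<omega>) + r * (X c \<omega> - X d \<omega>)" for \<omega>
  proof -
    have "k t * X t \<omega> = ((if t = a then X t \<omega> else 0) - (if t = b then X t \<omega> else 0))
      + r * ((if t = c then X t \<omega> else 0) - (if t = d then X t \<omega> else 0))" for t
      unfolding k_def by (simp add: algebra_simps)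
    moreover have "finite S" "a \<in> S" "b \<in> S" "c \<in> S" "d \<in> S" unfolding S_def by auto
    ultimately show ?thesis
      by (simp add: sum.distrib sum_subtractf sum_distrib_left[symmetric])
  qed
  moreover have "gaussian_rv M (\<lambda>\<omega>. \<Sum>t\<in>S. k t * X t \<omega>)"
    using nonneg by (intro gp(2)) (auto simp: S_def)
  ultimately have "gaussian_rv M (\<lambda>\<omega>. (X a \<omega> - X b \<omega>) + r * (X c \<omega> - X d \<omega>))" by simp
  then show ?thesis
    unfolding centred_gaussian_def using int nonneg mean by simp
qed

lemma fbm_gaussian:
  assumes "fractional_brownian_motion M H X" "0 \<le> t"
  shows "gaussian_rv M (X t)"
proof -
  have "\<And>S c. finite S \<Longrightarrow> S \<subseteq> {0..} \<Longrightarrow> gaussian_rv M (\<lambda>\<omega>. \<Sum>t\<in>S. c t * X t \<omega>)"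
    using assms(1) unfolding fractional_brownian_motion_def gaussian_process_def by blast
  from this[of "{t}" "\<lambda>_. 1"] show ?thesis using assms(2) by simp
qed

lemma fbm_measurable:
  "fractional_brownian_motion M H X \<Longrightarrow> 0 \<le> t \<Longrightarrow> X t \<in> borel_measurable M"
  using fbm_gaussian[of M H X t] by (simp add: gaussian_rv_def)

text \<open>With zero means the covariance is the product moment. The covariance formula does not
  yield integrability, which comes from the Gaussian fourth moments.\<close>

lemma fbm_product_moment:
  assumes fbm: "fractional_brownian_motion M H X" and nonneg: "0 \<le> u" "0 \<le> v"
  shows "integrable M (\<lambda>\<omega>. X u \<omega> * X v \<omega>)"
    "(\<integral>\<omega>. X u \<omega> * X v \<omega> \<partial>M) = (u powr (2 * H) + v powr (2 * H) - \<bar>u - v\<bar> powr (2 * H)) / 2"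
proof -
  have ps: "prob_space M"
    using fbm unfolding fractional_brownian_motion_def gaussian_process_def by blast
  have mean: "(\<integral>\<omega>. X t \<omega> \<partial>M) = 0" if "0 \<le> t" for t
    using fbm that unfolding fractional_brownian_motion_def by blast
  have sq: "integrable M (\<lambda>\<omega>. (X t \<omega>)\<^sup>2)" if "0 \<le> t" for t
  proof -
    interpret prob_space M by fact
    have "integrable M (\<lambda>\<omega>. X t \<omega> ^ 4)"
      by (rule gaussian_rv_mean_zero_moments(2)[OF ps fbm_gaussian[OF fbm that] mean[OF that]])
    then have "integrable M (\<lambda>\<omega>. ((X t \<omega>)\<^sup>2)\<^sup>2)" by (simp flip: power_mult)
    then show ?thesis
      by (rule square_integrable_imp_integrable[rotated])
        (use fbm_measurable[OF fbm that] in simp)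
  qed
  show "integrable M (\<lambda>\<omega>. X u \<omega> * X v \<omega>)"
    using nonneg fbm_measurable[OF fbm] sq by (intro integrable_mult_of_squares) auto
  have "\<forall>t1\<ge>0. \<forall>t2\<ge>0. cov M (X t1) (X t2) =
      (t1 powr (2 * H) + t2 powr (2 * H) - \<bar>t1 - t2\<bar> powr (2 * H)) / 2"
    using fbm unfolding fractional_brownian_motion_def by (elim conjE)
  from this[rule_format, OF nonneg]
  have "cov M (X u) (X v) = (u powr (2 * H) + v powr (2 * H) - \<bar>u - v\<bar> powr (2 * H)) / 2" .
  then show "(\<integral>\<omega>. X u \<omega> * X v \<omega> \<partial>M) =
      (u powr (2 * H) + v powr (2 * H) - \<bar>u - v\<bar> powr (2 * H)) / 2"
    unfolding cov_def mean[OF nonneg(1)] mean[OF nonneg(2)] diff_zero .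
qed

text \<open>Expanding the product cancels all powers of single times and leaves half the second
  difference of \<open>|x|^(2 H)\<close> at \<open>s - t\<close>. For \<open>s = t\<close> this is
  \<open>d^(2 H)\<close>, the variance of an increment.\<close>

lemma fbm_increment_cov:
  assumes fbm: "fractional_brownian_motion M H X" and "0 \<le> s" "0 \<le> t" "0 \<le> d"
  shows "(\<integral>\<omega>. (X (s + d) \<omega> - X s \<omega>) * (X (t + d) \<omega> - X t \<omega>) \<partial>M) =
    (\<bar>s - t + d\<bar> powr (2 * H) + \<bar>s - t - d\<bar> powr (2 * H) - 2 * \<bar>s - t\<bar> powr (2 * H)) / 2"
proof -
  note i = fbm_product_moment(1)[OF fbm] and c = fbm_product_moment(2)[OF fbm]
  have "(\<integral>\<omega>. (X (s + d) \<omega> - X s \<omega>) * (X (t + d) \<omega> - X t \<omega>) \<partial>M) =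
    (\<integral>\<omega>. X (s + d) \<omega> * X (t + d) \<omega> - X (s + d) \<omega> * X t \<omega> - X s \<omega> * X (t + d) \<omega> + X s \<omega> * X t \<omega> \<partial>M)"
    by (intro Bochner_Integration.integral_cong refl) (simp add: algebra_simps)
  also have "\<dots> = (\<integral>\<omega>. X (s + d) \<omega> * X (t + d) \<omega> \<partial>M) - (\<integral>\<omega>. X (s + d) \<omega> * X t \<omega> \<partial>M)
    - (\<integral>\<omega>. X s \<omega> * X (t + d) \<omega> \<partial>M) + (\<integral>\<omega>. X s \<omega> * X t \<omega> \<partial>M)"
    using i assms by simp
  also have "\<dots> = (\<bar>s - t + d\<bar> powr (2 * H) + \<bar>s - t - d\<bar> powr (2 * H) - 2 * \<bar>s - t\<bar> powr (2 * H)) / 2"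
  proof -
    have "\<bar>s + d - (t + d)\<bar> = \<bar>s - t\<bar>" "\<bar>s + d - t\<bar> = \<bar>s - t + d\<bar>"
      "\<bar>s - (t + d)\<bar> = \<bar>s - t - d\<bar>"
      by simp_all
    moreover have "0 \<le> s + d" "0 \<le> t + d" using assms by simp_all
    ultimately show ?thesis
      using c[of "s + d" "t + d"] c[of "s + d" t] c[of s "t + d"] c[of s t] assms(2,3)
      by (simp only: field_simps) simp
  qed
  finally show ?thesis .
qed

lemma tendsto_powr_zero: "0 < q \<Longrightarrow> ((\<lambda>d::real. d powr q) \<longlongrightarrow> 0) (at_right 0)"
  by (rule tendsto_powr'[where a = 0 and b = q, simplified])
    (auto intro!: tendsto_intros eventually_at_right_less[THEN eventually_mono])

text \<open>The lag \<open>d\<close> is independent of the spacing \<open>h\<close>, so this is not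
  the quadratic variation along a partition: with \<open>h\<close> fixed, a small \<open>d\<close>
  makes the increments short compared with the distances between them.\<close>

definition squared_increments :: "real \<Rightarrow> real \<Rightarrow> real \<Rightarrow> nat \<Rightarrow> (real \<Rightarrow> real) \<Rightarrow> real" where
  "squared_increments a h d N f = (\<Sum>i<N. (f (a + real i * h + d) - f (a + real i * h))\<^sup>2)"

text \<open>An increment has variance \<open>d^(2 H)\<close>, while covariances between different
  cells are at most of order \<open>d^2\<close>. The quotient is of order
  \<open>d^(2 - 2 H)\<close>, which vanishes with \<open>d\<close> because \<open>H < 1\<close>;
  hence the correlation bound \<open>1 / N\<close> holds for all small \<open>d\<close>.\<close>

lemma fbm_squared_increments_concentration:
  assumes fbm: "fractional_brownian_motion M H X" and "0 \<le> a" "0 < h" "0 < N"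
  shows "\<forall>\<^sub>F d in at_right 0. measure M {\<omega> \<in> space M.
    N / 2 \<le> \<bar>squared_increments a h d N (\<lambda>t. X t \<omega>) / d powr (2 * H) - N\<bar>} \<le> 16 / N"
proof -
  define p where "p = 2 * H"
  have p: "0 < p" "p < 2" and ps: "prob_space M"
    using fbm unfolding fractional_brownian_motion_def gaussian_process_def p_def by auto
  \<comment> \<open>The expression is \<open>N\<close> times the bound for the correlation of
    increments from different cells that is derived below.\<close>
  have "((\<lambda>d. 2 * real N * (h / 2) powr (p - 2) * d powr (2 - p)) \<longlongrightarrow>
      2 * real N * (h / 2) powr (p - 2) * 0) (at_right 0)"
    using p by (intro tendsto_mult tendsto_const tendsto_powr_zero) auto
  then have "\<forall>\<^sub>F d in at_right 0. 2 * real N * (h / 2) powr (p - 2) * d powr (2 - p) < 1"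
    by (rule order_tendstoD) simp
  \<comment> \<open>Distinct grid points are at least \<open>h\<close> apart, so their distance
    minus \<open>d\<close> stays above \<open>h / 2\<close>, a bound free of
    \<open>d\<close>.\<close>
  moreover have "\<forall>\<^sub>F d in at_right 0. d < h / 2"
    using \<open>0 < h\<close> by (intro eventually_at_rightI[of 0 "h / 2"]) auto
  ultimately show ?thesis
    using eventually_at_right_less[of "0::real"]
  proof eventually_elim
    case (elim d)
    define s where "s i = a + real i * h" for i :: nat
    have s: "0 \<le> s i" for i using assms by (simp add: s_def)
    define Y where "Y i \<omega> = X (s i + d) \<omega> - X (s i) \<omega>" for i \<omega>
    have cov: "(\<integral>\<omega>. Y i \<omega> * Y j \<omega> \<partial>M) =
        (\<bar>s i - s j + d\<bar> powr p + \<bar>s i - s j - d\<bar> powr p - 2 * \<bar>s i - s j\<bar> powr p) / 2" for i j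
      unfolding Y_def p_def using s elim by (intro fbm_increment_cov[OF fbm]) auto
    have corr: "\<bar>\<integral>\<omega>. Y i \<omega> * Y j \<omega> \<partial>M\<bar> \<le> d powr p / N" if "j < i" for i j
    proof -
      define u where "u = s i - s j"
      have "h * 1 \<le> h * (real i - real j)"
        using that \<open>0 < h\<close> by (intro mult_left_mono) auto
      then have u: "h \<le> u" unfolding u_def s_def by (simp add: algebra_simps)
      have "\<bar>\<integral>\<omega>. Y i \<omega> * Y j \<omega> \<partial>M\<bar> = \<bar>(u + d) powr p + (u - d) powr p - 2 * u powr p\<bar> / 2"
        using cov[of i j] u elim \<open>0 < h\<close> unfolding u_def[symmetric] by simp
      also have "\<dots> \<le> 4 * d\<^sup>2 * (u - d) powr (p - 2) / 2"
        using u elim p by (intro divide_right_mono second_difference_powr) auto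
      also have "\<dots> \<le> 4 * d\<^sup>2 * (h / 2) powr (p - 2) / 2"
        using u elim p \<open>0 < h\<close> by (intro divide_right_mono mult_left_mono powr_mono2') auto
      also have "\<dots> = (2 * real N * (h / 2) powr (p - 2) * d powr (2 - p)) * (d powr p / N)"
      proof -
        have "d\<^sup>2 = d powr (2 - p) * d powr p"
          using elim by (simp flip: powr_add add: powr_numeral)
        then show ?thesis using \<open>0 < N\<close> by simp
      qed
      also have "\<dots> \<le> 1 * (d powr p / N)"
        using elim by (intro mult_right_mono) auto
      finally show ?thesis by simp
    qed
    have "measure M {\<omega> \<in> space M. N / 2 \<le> \<bar>(\<Sum>i<N. (Y i \<omega>)\<^sup>2) / d powr p - N\<bar>} \<le> 16 / N"
    proof (rule sum_squares_concentration[OF ps])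
      show "centred_gaussian M (Y i)" for i
        unfolding Y_def using fbm_centred[OF fbm, of "s i + d" "s i" 0 0 0] s elim by simp
      show "centred_gaussian M (\<lambda>\<omega>. Y i \<omega> + Y j \<omega>)" for i j
        unfolding Y_def using fbm_centred[OF fbm, of "s i + d" "s i" "s j + d" "s j" 1] s elim by simp
      show "centred_gaussian M (\<lambda>\<omega>. Y i \<omega> - Y j \<omega>)" for i j
        unfolding Y_def using fbm_centred[OF fbm, of "s i + d" "s i" "s j" "s j + d" 1] s elim
        by (simp add: algebra_simps)
      show "(\<integral>\<omega>. (Y i \<omega>)\<^sup>2 \<partial>M) = d powr p" for i
        using cov[of i i] elim by (simp add: power2_eq_square)
      show "0 < d powr p" using elim by simp
      show "\<bar>\<integral>\<omega>. Y i \<omega> * Y j \<omega> \<partial>M\<bar> \<le> d powr p / N" if "i \<noteq> j" for i j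
        using corr[of i j] corr[of j i] that by (simp add: mult.commute nat_neq_iff) argo
      show "0 < N" by fact
    qed
    then show ?case unfolding squared_increments_def Y_def s_def p_def .
  qed
qed

section \<open>Singularity of the path distributions\<close>

lemma prob_space_path_distr:
  assumes "prob_space M" "path_on I X \<in> measurable (completion M) (C_borel I)"
  shows "prob_space (path_distr M I X)"
  unfolding path_distr_def
  by (intro prob_space.prob_space_distr prob_space.prob_space_completion assms)

text \<open>The modified and the raw path agree on \<open>I\<close> almost surely, and
  \<open>local\<close> says that \<open>P\<close> sees only the values on \<open>I\<close>. The
  predicate ranges over all functions because the raw path need not belong to
  \<open>C_carrier I\<close>.\<close>

lemma measure_path_distr:
  assumes path: "path_on I X \<in> measurable (completion M) (C_borel I)" "continuous_paths_on M I X"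
    and B: "{f \<in> space (C_borel I). P f} \<in> sets (C_borel I)"
    and P: "{\<omega> \<in> space M. P (\<lambda>t. X t \<omega>)} \<in> sets M"
    and local: "\<And>f g. (\<forall>t\<in>I. f t = g t) \<Longrightarrow> P f = P g"
  shows "measure (path_distr M I X) {f \<in> space (C_borel I). P f}
    = measure M {\<omega> \<in> space M. P (\<lambda>t. X t \<omega>)}"
proof -
  let ?B = "{f \<in> space (C_borel I). P f}"
  have "measure (path_distr M I X) ?B = measure (completion M) (path_on I X -` ?B \<inter> space M)"
    unfolding path_distr_def using path B by (simp add: measure_distr)
  also have "\<dots> = measure (completion M) {\<omega> \<in> space M. P (\<lambda>t. X t \<omega>)}"
  proof (rule measure_eq_AE)
    show "AE \<omega> in completion M. \<omega> \<in> path_on I X -` ?B \<inter> space M \<longleftrightarrow> \<omega> \<in> {\<omega> \<in> space M. P (\<lambda>t. X t \<omega>)}"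
      using AE_completion[OF AE_path_on_eq[OF path(2)]]
    proof eventually_elim
      case (elim \<omega>)
      then show ?case
        using local[of "path_on I X \<omega>" "\<lambda>t. X t \<omega>"] path_on_in_C_carrier by auto
    qed
    show "path_on I X -` ?B \<inter> space M \<in> sets (completion M)"
      using measurable_sets[OF path(1) B] by simp
    show "{\<omega> \<in> space M. P (\<lambda>t. X t \<omega>)} \<in> sets (completion M)" using P by simp
  qed
  also have "\<dots> = measure M {\<omega> \<in> space M. P (\<lambda>t. X t \<omega>)}" using P by simp
  finally show ?thesis .
qed

text \<open>The separating set is the limit inferior of the chosen sets. Borel-Cantelli under
  \<open>P\<close>, applied to the complements, puts almost every point eventually inside; under
  \<open>Q\<close> it puts almost every point eventually outside.\<close>

lemma singular_if_asymptotically_separated: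
  assumes "prob_space P" "prob_space Q" and sets: "sets P = sets Q"
    and sep: "\<And>n::nat. \<exists>A\<in>sets P. measure P A \<ge> 1 - c n \<and> measure Q A \<le> c n"
    and c: "summable c"
  shows "\<exists>A\<in>sets P. emeasure P A = 1 \<and> emeasure Q A = 0"
proof -
  interpret P: prob_space P by fact
  interpret Q: prob_space Q by fact
  obtain A where A: "\<And>n. A n \<in> sets P" "\<And>n. measure P (A n) \<ge> 1 - c n" "\<And>n. measure Q (A n) \<le> c n"
    using sep by metis
  note [measurable] = A(1)
  have AQ [measurable]: "A n \<in> sets Q" for n using A(1) sets by simp
  let ?L = "{\<omega> \<in> space P. \<forall>\<^sub>F n in sequentially. \<omega> \<in> A n}"
  have L: "?L \<in> sets P" unfolding eventually_sequentially by measurable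
  have "AE \<omega> in P. \<forall>\<^sub>F n in sequentially. \<omega> \<in> space P - (space P - A n)"
  proof (rule borel_cantelli_AE1)
    show "summable (\<lambda>n. measure P (space P - A n))"
      using A(2) by (intro summable_comparison_test'[OF c, of 0]) (auto simp: P.prob_compl algebra_simps)
  qed (auto simp: P.emeasure_eq_measure)
  then have "AE \<omega> in P. \<omega> \<in> ?L"
    using AE_space by eventually_elim (auto elim: eventually_mono)
  then have "emeasure P ?L = 1" using L by (intro P.emeasure_eq_1_AE)
  moreover have "AE \<omega> in Q. \<forall>\<^sub>F n in sequentially. \<omega> \<in> space Q - A n"
  proof (rule borel_cantelli_AE1)
    show "summable (\<lambda>n. measure Q (A n))"
      using A(3) by (intro summable_comparison_test'[OF c, of 0]) auto
  qed (auto simp: Q.emeasure_eq_measure)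
  then have "AE \<omega> in Q. \<omega> \<notin> ?L"
  proof eventually_elim
    case (elim \<omega>)
    show ?case
    proof
      assume "\<omega> \<in> ?L"
      then have "\<forall>\<^sub>F n in sequentially. \<omega> \<in> A n" by simp
      with elim have "\<forall>\<^sub>F n::nat in sequentially. False" by eventually_elim auto
      then show False by simp
    qed
  qed
  then have "emeasure Q ?L = 0" using L sets
    by (intro AE_iff_measurable[THEN iffD1, rotated 2])
      (auto dest: sets.sets_into_space simp: sets_eq_imp_space_eq[OF sets])
  ultimately show ?thesis using L by blast
qed

section \<open>Separation of the two laws by events on squared increments\<close>

theorem corollary3p6:
  fixes I :: "real set" and H1 H2 :: real
    and M1 :: "'a measure" and X1 :: "real \<Rightarrow> 'a \<Rightarrow> real"
    and M2 :: "'b measure" and X2 :: "real \<Rightarrow> 'b \<Rightarrow> real"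
  assumes "I \<subseteq> {0..}" and "is_interval I" and "closed I" and "\<exists>a\<in>I. \<exists>b\<in>I. a < b"
    and "0 < H1" and "H1 < 1" and "0 < H2" and "H2 < 1" and "H1 \<noteq> H2"
    and "fractional_brownian_motion M1 H1 X1" and "continuous_paths_on M1 {0..} X1"
    and "fractional_brownian_motion M2 H2 X2" and "continuous_paths_on M2 {0..} X2"
  shows "singular_on I M1 X1 M2 X2"
proof -
  note fbm = assms(10,12)
  have ps: "prob_space M1" "prob_space M2"
    using fbm unfolding fractional_brownian_motion_def gaussian_process_def by blast+
  have cont: "continuous_paths_on M1 I X1" "continuous_paths_on M2 I X2"
    using assms(11,13) assms(1) unfolding continuous_paths_on_def
    by (auto elim!: eventually_mono intro: continuous_on_subset)
  have X: "X1 t \<in> borel_measurable M1" "X2 t \<in> borel_measurable M2" if "t \<in> I" for t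
    using fbm_measurable[OF fbm(1), of t] fbm_measurable[OF fbm(2), of t] that assms(1) by auto
  have path: "path_on I X1 \<in> measurable (completion M1) (C_borel I)"
    "path_on I X2 \<in> measurable (completion M2) (C_borel I)"
    using measurable_path_on[OF assms(3)] X cont by blast+
  obtain a b where ab: "a \<in> I" "b \<in> I" "a < b" using assms(4) by blast
  have "0 \<le> a" using ab assms(1) by auto
  have sub: "{a..b} \<subseteq> I" using mem_is_interval_1_I[OF assms(2) ab(1,2)] by auto
  \<comment> \<open>The Chebyshev error \<open>16 / N\<close> for \<open>N = 2 ^ n\<close> cells;
    geometric growth of \<open>N\<close> makes it summable.\<close>
  define c where "c n = 16 / real (2 ^ n)" for n :: nat
  have "summable (\<lambda>n. 16 * (1 / 2 :: real) ^ n)" by (intro summable_mult summable_geometric) simp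
  then have "summable c" by (simp add: c_def[abs_def] power_divide)
  moreover have "\<exists>A\<in>sets (path_distr M1 I X1). measure (path_distr M1 I X1) A \<ge> 1 - c n \<and>
    measure (path_distr M2 I X2) A \<le> c n" for n
  proof -
    define N :: nat where "N = 2 ^ n"
    have "0 < N" unfolding N_def by simp
    define h where "h = (b - a) / N"
    have "0 < h" using ab \<open>0 < N\<close> unfolding h_def by simp
    \<comment> \<open>The quotient of the two scales \<open>d^(2 H2)\<close> and
      \<open>d^(2 H1)\<close>.\<close>
    let ?r = "\<lambda>d. d powr (2 * (H2 - H1))"
    \<comment> \<open>Two numbers in \<open>(1/2, 3/2)\<close> have a quotient in
      \<open>(1/3, 3)\<close>, whence the thresholds. As \<open>d\<close> tends to zero,
      \<open>?r d\<close> tends to zero or to infinity according to the sign of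
      \<open>H2 - H1\<close>; the second case passes to inverses.\<close>
    have ratio: "\<forall>\<^sub>F d in at_right 0. ?r d < 1 / 3 \<or> 3 < ?r d"
    proof (cases "H1 < H2")
      case True
      then have "((\<lambda>d. ?r d) \<longlongrightarrow> 0) (at_right 0)" by (intro tendsto_powr_zero) simp
      then have "\<forall>\<^sub>F d in at_right 0. ?r d < 1 / 3" by (rule order_tendstoD) simp
      then show ?thesis by eventually_elim simp
    next
      case False
      then have "((\<lambda>d::real. d powr (2 * (H1 - H2))) \<longlongrightarrow> 0) (at_right 0)"
        using \<open>H1 \<noteq> H2\<close> by (intro tendsto_powr_zero) simp
      then have "\<forall>\<^sub>F d::real in at_right 0. d powr (2 * (H1 - H2)) < 1 / 3" by (rule order_tendstoD) simp
      then show ?thesis using eventually_at_right_less[of "0::real"]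
      proof eventually_elim
        case (elim d)
        have "2 * (H2 - H1) = - (2 * (H1 - H2))" by simp
        then have r: "?r d = inverse (d powr (2 * (H1 - H2)))" by (simp only: powr_minus)
        have "inverse (1 / 3) < inverse (d powr (2 * (H1 - H2)))"
          using elim by (intro less_imp_inverse_less) auto
        then show ?case unfolding r by simp
      qed
    qed
    have "\<forall>\<^sub>F d in at_right 0. d < h"
      using \<open>0 < h\<close> by (intro eventually_at_rightI[of 0 h]) auto
    with ratio fbm_squared_increments_concentration[OF fbm(1) \<open>0 \<le> a\<close> \<open>0 < h\<close> \<open>0 < N\<close>]
      fbm_squared_increments_concentration[OF fbm(2) \<open>0 \<le> a\<close> \<open>0 < h\<close> \<open>0 < N\<close>]
      eventually_at_right_less[of "0::real"]
    have "\<forall>\<^sub>F d in at_right 0. 0 < d \<and> d < h \<and> (?r d < 1 / 3 \<or> 3 < ?r d) \<and>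
      measure M1 {\<omega> \<in> space M1. N / 2 \<le> \<bar>squared_increments a h d N (\<lambda>t. X1 t \<omega>) / d powr (2 * H1) - N\<bar>} \<le> 16 / N \<and>
      measure M2 {\<omega> \<in> space M2. N / 2 \<le> \<bar>squared_increments a h d N (\<lambda>t. X2 t \<omega>) / d powr (2 * H2) - N\<bar>} \<le> 16 / N"
      by eventually_elim blast
    \<comment> \<open>One lag is fixed for each \<open>n\<close>; all requirements hold for every
      sufficiently small positive \<open>d\<close>, so they can be met together.\<close>
    then obtain d where d: "0 < d" "d < h" "?r d < 1 / 3 \<or> 3 < ?r d"
      "measure M1 {\<omega> \<in> space M1. N / 2 \<le> \<bar>squared_increments a h d N (\<lambda>t. X1 t \<omega>) / d powr (2 * H1) - N\<bar>} \<le> 16 / N"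
      "measure M2 {\<omega> \<in> space M2. N / 2 \<le> \<bar>squared_increments a h d N (\<lambda>t. X2 t \<omega>) / d powr (2 * H2) - N\<bar>} \<le> 16 / N"
      using eventually_happens'[OF trivial_limit_at_right_real] by blast
    let ?Q = "squared_increments a h d N"
    \<comment> \<open>Since \<open>d < h\<close>, each increment ends within its own cell, the last
      one before \<open>b\<close>.\<close>
    have grid: "a + real i * h \<in> I" "a + real i * h + d \<in> I" if "i < N" for i
    proof -
      have "real (Suc i) * h \<le> real N * h" using that \<open>0 < h\<close> by (intro mult_right_mono) auto
      also have "real N * h = b - a" unfolding h_def using \<open>0 < N\<close> by simp
      finally have "real i * h + h \<le> b - a" by (simp add: algebra_simps)
      moreover have "0 \<le> real i * h" using \<open>0 < h\<close> by simp
      ultimately have "a + real i * h \<in> {a..b}" "a + real i * h + d \<in> {a..b}"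
        using d(1,2) unfolding atLeastAtMost_iff by linarith+
      then show "a + real i * h \<in> I" "a + real i * h + d \<in> I" using sub by blast+
    qed
    have [measurable]: "?Q \<in> borel_measurable (C_borel I)"
      "(\<lambda>\<omega>. ?Q (\<lambda>t. X1 t \<omega>)) \<in> borel_measurable M1"
      "(\<lambda>\<omega>. ?Q (\<lambda>t. X2 t \<omega>)) \<in> borel_measurable M2"
      unfolding squared_increments_def
      using grid X measurable_C_eval
      by (intro borel_measurable_sum borel_measurable_power borel_measurable_diff; simp)+
    \<comment> \<open>The squared increments are of the size typical for \<open>H1\<close>, namely
      strictly between \<open>N / 2\<close> and \<open>3 * N / 2\<close> times
      \<open>d^(2 H1)\<close>.\<close>
    define B where "B f \<longleftrightarrow> \<bar>?Q f / d powr (2 * H1) - N\<bar> < N / 2" for f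
    have [measurable]: "Measurable.pred (C_borel I) B" unfolding B_def by measurable
    have local: "B f = B g" if "\<forall>t\<in>I. f t = g t" for f g
    proof -
      have "?Q f = ?Q g" unfolding squared_increments_def
        using that grid by (intro sum.cong) auto
      then show ?thesis unfolding B_def by simp
    qed
    let ?A = "{f \<in> space (C_borel I). B f}"
    have A: "?A \<in> sets (C_borel I)" by measurable
    have "measure (path_distr M1 I X1) ?A = measure M1 {\<omega> \<in> space M1. B (\<lambda>t. X1 t \<omega>)}"
    proof (rule measure_path_distr[OF path(1) cont(1) A])
      show "{\<omega> \<in> space M1. B (\<lambda>t. X1 t \<omega>)} \<in> sets M1" unfolding B_def by measurable
    qed (rule local)
    also have "{\<omega> \<in> space M1. B (\<lambda>t. X1 t \<omega>)} = space M1 -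
        {\<omega> \<in> space M1. N / 2 \<le> \<bar>?Q (\<lambda>t. X1 t \<omega>) / d powr (2 * H1) - N\<bar>}"
      unfolding B_def by auto
    also have "measure M1 \<dots> \<ge> 1 - 16 / N"
      using d(4) by (subst prob_space.prob_compl[OF ps(1)]) simp_all
    finally have 1: "measure (path_distr M1 I X1) ?A \<ge> 1 - c n" unfolding c_def N_def by simp
    have "measure (path_distr M2 I X2) ?A = measure M2 {\<omega> \<in> space M2. B (\<lambda>t. X2 t \<omega>)}"
    proof (rule measure_path_distr[OF path(2) cont(2) A])
      show "{\<omega> \<in> space M2. B (\<lambda>t. X2 t \<omega>)} \<in> sets M2" unfolding B_def by measurable
    qed (rule local)
    also have "\<dots> \<le> measure M2
      {\<omega> \<in> space M2. N / 2 \<le> \<bar>?Q (\<lambda>t. X2 t \<omega>) / d powr (2 * H2) - N\<bar>}"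
    proof (rule finite_measure.finite_measure_mono)
      show "finite_measure M2" using ps(2) by (rule prob_space.finite_measure)
      \<comment> \<open>A value typical for both parameters would put \<open>w\<close> and
        \<open>w * ?r d\<close> into \<open>(N / 2, 3 * N / 2)\<close>, forcing \<open>?r d\<close>
        into \<open>(1/3, 3)\<close> against the choice of \<open>d\<close>.\<close>
      have "N / 2 \<le> \<bar>x / d powr (2 * H2) - N\<bar>" if x: "\<bar>x / d powr (2 * H1) - N\<bar> < N / 2" for x
      proof (rule ccontr)
        assume c: "\<not> N / 2 \<le> \<bar>x / d powr (2 * H2) - N\<bar>"
        define w where "w = x / d powr (2 * H2)"
        have w: "N / 2 < w" "w < 3 * N / 2"
          using c unfolding w_def[symmetric] by linarith+
        have "x / d powr (2 * H1) = w * ?r d"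
          using d(1) unfolding w_def by (simp add: powr_diff right_diff_distrib)
        then have x: "N / 2 < w * ?r d" "w * ?r d < 3 * N / 2" using x by linarith+
        from d(3) show False
        proof
          assume "?r d < 1 / 3"
          then have "w * ?r d \<le> w * (1 / 3)" using w by (intro mult_left_mono) auto
          then show False using x w by linarith
        next
          assume "3 < ?r d"
          then have "w * 3 \<le> w * ?r d" using w by (intro mult_left_mono) auto
          then show False using x w by linarith
        qed
      qed
      then show "{\<omega> \<in> space M2. B (\<lambda>t. X2 t \<omega>)} \<subseteq>
          {\<omega> \<in> space M2. N / 2 \<le> \<bar>?Q (\<lambda>t. X2 t \<omega>) / d powr (2 * H2) - N\<bar>}"
        unfolding B_def by blast
      show "{\<omega> \<in> space M2. N / 2 \<le> \<bar>?Q (\<lambda>t. X2 t \<omega>) / d powr (2 * H2) - N\<bar>} \<in> sets M2"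
        by measurable
    qed
    also have "\<dots> \<le> c n" using d(5) unfolding c_def N_def by simp
    finally have "measure (path_distr M2 I X2) ?A \<le> c n" .
    with 1 A show ?thesis by (intro bexI[of _ ?A]) (auto simp: path_distr_def)
  qed
  ultimately have "\<exists>A\<in>sets (path_distr M1 I X1).
      emeasure (path_distr M1 I X1) A = 1 \<and> emeasure (path_distr M2 I X2) A = 0"
    using singular_if_asymptotically_separated[OF prob_space_path_distr[OF ps(1) path(1)]
        prob_space_path_distr[OF ps(2) path(2)], of c]
    by (simp add: path_distr_def)
  then show ?thesis unfolding singular_on_def by (simp add: path_distr_def)
qed

end
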